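(* Let $i,j,k$ be nonnegative integers and $N\ge1$ an integer. Then \[ \pi_N\bigl(\operatorname{Supp}(C^{Nk}_{Ni,Nj})\bigr)=\operatorname{Supp}\bigl((C^k_{i,j})^N\bigr). \]
   Context: For the equivariant cohomology of projective space $\mathbb{P}^n$ under the diagonal torus, with $H_T^*(\mathrm{pt})=\mathbb{Z}[t_1,\dots,t_{n+1}]$, let $\sigma_k=\prod_{m=1}^k(\zeta+t_m)$ ($\zeta=c_1^T(\mathcal{O}(1))$) be the class of the codimension-$k$ coordinate subspace $\{x_0=\dots=x_{k-1}=0\}$, and define $C^k_{i,j}$ by $\sigma_i\sigma_j=\sum_kC^k_{i,j}\sigma_k$. These constants, written as polynomials in $\beta_m=t_m-t_{m+1}$, do not depend on $n$ once $n$ is large, and one works in $H_T^*(\mathbb{P}^\infty)$, regarding $C^k_{i,j}$ as elements of $\mathbb{Z}[\beta_1,\beta_2,\dots]$. The support $\operatorname{Supp}$ of such a polynomial is the set of exponent vectors (finitely supported vectors in $\mathbb{Z}_{\ge0}^\infty\subset\mathbb{R}^\infty$) of its monomials with nonzero coefficient. The linear map $\pi_N:\mathbb{R}^\infty\to\mathbb{R}^\infty$ is $\pi_N(x_1,x_2,\dots)=\bigl(\sum_{m=1}^Nx_m,\ \sum_{m=N+1}^{2N}x_m,\ \sum_{m=2N+1}^{3N}x_m,\dots\bigr)$. *)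

theory Defs
  imports "HOL-Library.Poly_Mapping" "HOL-Computational_Algebra.Polynomial"
begin

text \<open>
  Integer polynomials in countably many variables: a polynomial is a finitely supported
  family of coefficients, indexed by exponent vectors, with the convolution product of
  \<^theory>\<open>HOL-Library.Poly_Mapping\<close>.  All indices start at 0, so the \<open>m\<close>-th variable
  here is the one usually numbered \<open>m + 1\<close>.
\<close>

type_synonym int_mpoly = "(nat \<Rightarrow>\<^sub>0 nat) \<Rightarrow>\<^sub>0 int"

definition mvar :: "nat \<Rightarrow> int_mpoly" where
  "mvar m = Poly_Mapping.single (Poly_Mapping.single m 1) 1"

definition mpoly_subst :: "(nat \<Rightarrow> int_mpoly) \<Rightarrow> int_mpoly \<Rightarrow> int_mpoly" where
  "mpoly_subst f = frag_extend
     (\<lambda>e. \<Prod>m\<in>Poly_Mapping.keys e. f m ^ Poly_Mapping.lookup e m)"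

text \<open>
  The equivariant cohomology ring \<open>H\<^sub>T\<^sup>*(P\<^sup>\<infinity>)\<close> is represented by its standard presentation
  as the polynomial ring in \<open>\<zeta>\<close> over \<open>H\<^sub>T\<^sup>*(pt) = \<int>[t\<^sub>0, t\<^sub>1, \<dots>]\<close>, that is, by the type
  \<^typ>\<open>int_mpoly poly\<close>, whose polynomial variable is \<open>\<zeta>\<close>.  In the same way
  \<open>H\<^sub>T\<^sup>*(P\<^sup>n)\<close>, with scalars extended from \<open>\<int>[t\<^sub>0, \<dots>, t\<^sub>n]\<close> to all the \<open>t\<^sub>m\<close>, is its
  quotient by \<open>\<sigma>\<^sub>n\<^sub>+\<^sub>1 = (\<zeta> + t\<^sub>0) \<cdots> (\<zeta> + t\<^sub>n)\<close>; \<open>struct_const_finite\<close> below compares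
  the structure constants.
\<close>

definition sigma :: "nat \<Rightarrow> int_mpoly poly" where
  "sigma k = (\<Prod>m<k. [:mvar m, 1:])"

definition sigma_coords :: "int_mpoly poly \<Rightarrow> (nat \<Rightarrow>\<^sub>0 int_mpoly)" where
  "sigma_coords p = (THE c. p =
     (\<Sum>k\<in>Poly_Mapping.keys c. smult (Poly_Mapping.lookup c k) (sigma k)))"

definition struct_const_t :: "nat \<Rightarrow> nat \<Rightarrow> nat \<Rightarrow> int_mpoly" where
  "struct_const_t i j k = Poly_Mapping.lookup (sigma_coords (sigma i * sigma j)) k"

text \<open>
  \<open>beta_to_t\<close> embeds \<open>\<int>[\<beta>\<^sub>0, \<beta>\<^sub>1, \<dots>]\<close> into \<open>\<int>[t\<^sub>0, t\<^sub>1, \<dots>]\<close>; the two rings share the type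
  \<^typ>\<open>int_mpoly\<close>, and \<open>struct_const\<close> is the structure constant as an element of the former.
\<close>

definition beta_to_t :: "int_mpoly \<Rightarrow> int_mpoly" where
  "beta_to_t = mpoly_subst (\<lambda>m. mvar m - mvar (Suc m))"

definition struct_const :: "nat \<Rightarrow> nat \<Rightarrow> nat \<Rightarrow> int_mpoly" where
  "struct_const i j k = (THE p. beta_to_t p = struct_const_t i j k)"

definition Supp :: "int_mpoly \<Rightarrow> (nat \<Rightarrow> real) set" where
  "Supp p = (\<lambda>e m. real (Poly_Mapping.lookup e m)) ` Poly_Mapping.keys p"

definition block_proj :: "nat \<Rightarrow> (nat \<Rightarrow> real) \<Rightarrow> (nat \<Rightarrow> real)" where
  "block_proj N x = (\<lambda>q. \<Sum>m = q * N..<(q + 1) * N. x m)"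


subsection \<open>The definite descriptions are well defined\<close>

definition mono_val :: "(nat \<Rightarrow> int_mpoly) \<Rightarrow> (nat \<Rightarrow>\<^sub>0 nat) \<Rightarrow> int_mpoly" where
  "mono_val f e = (\<Prod>m\<in>Poly_Mapping.keys e. f m ^ Poly_Mapping.lookup e m)"

lemma mpoly_subst_alt: "mpoly_subst f = frag_extend (mono_val f)"
  by (simp add: mpoly_subst_def mono_val_def[abs_def])

lemma mono_val_superset:
  assumes "finite A" "Poly_Mapping.keys e \<subseteq> A"
  shows "mono_val f e = (\<Prod>m\<in>A. f m ^ Poly_Mapping.lookup e m)"
  unfolding mono_val_def using assms
  by (intro prod.mono_neutral_left) (auto simp: in_keys_iff)

lemma mono_val_add: "mono_val f (a + b) = mono_val f a * mono_val f b"
proof -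
  let ?A = "Poly_Mapping.keys a \<union> Poly_Mapping.keys b"
  have "Poly_Mapping.keys (a + b) \<subseteq> ?A" by (rule Poly_Mapping.keys_add)
  then show ?thesis
    by (simp add: mono_val_superset[of ?A] lookup_add power_add prod.distrib)
qed

lemma frag_of_mult: "frag_of a * frag_of b = (frag_of (a + b) :: int_mpoly)"
  by (simp add: mult_single)

lemma mpoly_subst_diff: "mpoly_subst f (p - q) = mpoly_subst f p - mpoly_subst f q"
  by (simp add: mpoly_subst_alt frag_extend_diff)

lemma mpoly_subst_0 [simp]: "mpoly_subst f 0 = 0"
  by (simp add: mpoly_subst_alt)

lemma mpoly_subst_add: "mpoly_subst f (p + q) = mpoly_subst f p + mpoly_subst f q"
  by (simp add: mpoly_subst_alt frag_extend_add)

lemma mpoly_subst_minus: "mpoly_subst f (- p) = - mpoly_subst f p"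
  by (simp add: mpoly_subst_alt frag_extend_minus)

lemma mpoly_subst_sum: "mpoly_subst f (sum g A) = (\<Sum>x\<in>A. mpoly_subst f (g x))"
  by (induction A rule: infinite_finite_induct) (simp_all add: mpoly_subst_add)

lemma mpoly_subst_frag_of: "mpoly_subst f (frag_of e) = mono_val f e"
  by (simp add: mpoly_subst_alt)

lemma mpoly_subst_mult: "mpoly_subst f (p * q) = mpoly_subst f p * mpoly_subst f q"
using subset_UNIV[of "Poly_Mapping.keys p"]
proof (induction p rule: frag_induction)
  case (one a)
  show ?case
    using subset_UNIV[of "Poly_Mapping.keys q"]
  proof (induction q rule: frag_induction)
    case (one b)
    show ?case by (simp add: frag_of_mult mpoly_subst_frag_of mono_val_add)
  qed (simp_all add: mpoly_subst_diff right_diff_distrib)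
qed (simp_all add: mpoly_subst_diff left_diff_distrib)

lemma mpoly_subst_1: "mpoly_subst f 1 = 1"
proof -
  have "mpoly_subst f (frag_of 0) = 1" by (simp only: mpoly_subst_frag_of) (simp add: mono_val_def)
  then show ?thesis by simp
qed

lemma mpoly_subst_power: "mpoly_subst f (p ^ n) = mpoly_subst f p ^ n"
  by (induction n) (simp_all add: mpoly_subst_1 mpoly_subst_mult)

lemma mpoly_subst_prod: "mpoly_subst f (prod g A) = (\<Prod>x\<in>A. mpoly_subst f (g x))"
  by (induction A rule: infinite_finite_induct) (simp_all add: mpoly_subst_1 mpoly_subst_mult)

lemma mpoly_subst_mvar [simp]: "mpoly_subst f (mvar m) = f m"
proof -
  have "mvar m = frag_of (Poly_Mapping.single m 1)" by (simp add: mvar_def)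
  then show ?thesis by (simp add: mpoly_subst_frag_of mono_val_def)
qed

lemma single_power:
  "(Poly_Mapping.single (Poly_Mapping.single m 1) 1 :: int_mpoly) ^ n
     = Poly_Mapping.single (Poly_Mapping.single m n) 1"
  by (induction n) (simp_all add: mult_single flip: single_add)

lemma sum_single: "(\<Sum>m\<in>Poly_Mapping.keys e. Poly_Mapping.single m (Poly_Mapping.lookup e m)) = e"
  by (rule poly_mapping_eqI) (auto simp: lookup_sum lookup_single when_def in_keys_iff)

lemma mono_val_mvar: "mono_val mvar e = frag_of e"
proof -
  have "(\<Prod>m\<in>A. mvar m ^ Poly_Mapping.lookup e m)
      = Poly_Mapping.single (\<Sum>m\<in>A. Poly_Mapping.single m (Poly_Mapping.lookup e m)) 1" for A
    by (induction A rule: infinite_finite_induct)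
       (simp_all add: mvar_def single_power[unfolded One_nat_def] mult_single)
  then show ?thesis by (simp add: mono_val_def sum_single)
qed

lemma mpoly_subst_id: "mpoly_subst mvar p = p"
  using frag_expansion[of p] by (simp add: mpoly_subst_alt mono_val_mvar[abs_def] frag_extend_def)

lemma mpoly_subst_comp: "mpoly_subst g (mpoly_subst f p) = mpoly_subst (\<lambda>m. mpoly_subst g (f m)) p"
using subset_UNIV[of "Poly_Mapping.keys p"]
proof (induction p rule: frag_induction)
  case (one a)
  show ?case
    by (simp add: mpoly_subst_frag_of mono_val_def mpoly_subst_prod mpoly_subst_power)
qed (simp_all add: mpoly_subst_diff)

definition t_shift :: "nat \<Rightarrow> int_mpoly" where
  "t_shift m = - (\<Sum>l<m. mvar l)"

lemma inj_beta_to_t: "inj beta_to_t"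
proof (rule inj_on_inverseI)
  fix p
  have "(\<lambda>m. mpoly_subst t_shift (mvar m - mvar (Suc m))) = mvar"
    by (simp add: fun_eq_iff mpoly_subst_diff t_shift_def)
  then show "mpoly_subst t_shift (beta_to_t p) = p"
    by (simp add: beta_to_t_def mpoly_subst_comp mpoly_subst_id)
qed

lemma beta_to_t_shift: "beta_to_t (t_shift m) = mvar m - mvar 0"
proof -
  have "(\<Sum>l<m. mvar l - mvar (Suc l)) = mvar 0 - mvar m"
    by (induction m) simp_all
  then show ?thesis
    by (simp add: beta_to_t_def t_shift_def mpoly_subst_minus mpoly_subst_sum)
qed

lemma sigma_0 [simp]: "sigma 0 = 1"
  by (simp add: sigma_def)

lemma sigma_Suc: "sigma (Suc k) = sigma k * [:mvar k, 1:]"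
  by (simp add: sigma_def)

lemma sigma_degree_lead: "degree (sigma k) = k \<and> lead_coeff (sigma k) = 1"
proof (induction k)
  case (Suc k)
  have "lead_coeff (sigma (Suc k)) = lead_coeff (sigma k) * lead_coeff [:mvar k, 1:]"
    unfolding sigma_Suc by (rule lead_coeff_mult)
  moreover have "sigma k \<noteq> 0" using Suc by auto
  then have "degree (sigma (Suc k)) = degree (sigma k) + degree [:mvar k, 1:]"
    unfolding sigma_Suc by (intro degree_mult_eq) auto
  ultimately have "lead_coeff (sigma (Suc k)) = 1" "degree (sigma (Suc k)) = Suc k"
    using conjunct1[OF Suc.IH] conjunct2[OF Suc.IH] by auto
  then show ?case by (rule conjI[rotated])
qed simp

lemma coeff_sigma_self [simp]: "coeff (sigma k) k = 1"
  using sigma_degree_lead[of k] by metis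

lemma degree_sigma [simp]: "degree (sigma k) = k"
  using sigma_degree_lead[of k] by simp

lemma sigma_sum_degree: "degree (\<Sum>k<n. smult (c k) (sigma k)) < n \<or> n = 0"
  by (cases n) (auto simp: lessThan_Suc_atMost less_Suc_eq_le intro!: degree_sum_le
      order.trans[OF degree_smult_le])

lemma sigma_sum_eq_0:
  assumes "(\<Sum>k<n. smult (c k) (sigma k)) = 0" "k < n"
  shows "c k = 0"
  using assms
proof (induction n)
  case (Suc n)
  have "coeff (\<Sum>k<n. smult (c k) (sigma k)) n = 0"
    using sigma_sum_degree[of c n] by (auto intro: coeff_eq_0)
  moreover have "coeff (\<Sum>k<Suc n. smult (c k) (sigma k)) n = 0" using Suc.prems by simp
  ultimately have "c n = 0" by simp
  with Suc show ?case by (auto simp: less_Suc_eq)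
qed simp

lemma sigma_expansion_exists:
  "degree p < n \<Longrightarrow> \<exists>c. p = (\<Sum>k<n. smult (c k) (sigma k))"
proof (induction n arbitrary: p)
  case (Suc n)
  define q where "q = p - smult (coeff p n) (sigma n)"
  have "\<exists>c. q = (\<Sum>k<n. smult (c k) (sigma k))"
  proof (cases "n = 0")
    case True
    with Suc.prems show ?thesis
      by (auto simp: q_def elim!: degree_eq_zeroE)
  next
    case False
    have "degree q \<le> n"
      unfolding q_def using Suc.prems
      by (intro degree_diff_le order.trans[OF degree_smult_le]) auto
    moreover have "coeff q n = 0" by (simp add: q_def)
    ultimately have "degree q < n"
      using False by (metis degree_0 leading_coeff_0_iff le_neq_implies_less gr0I)
    then show ?thesis by (rule Suc.IH)
  qed
  then obtain c where c: "q = (\<Sum>k<n. smult (c k) (sigma k))" ..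
  have "p = (\<Sum>k<Suc n. smult ((c(n := coeff p n)) k) (sigma k))"
    using c by (simp add: q_def algebra_simps)
  then show ?case by blast
qed simp

lemma sum_keys_lessThan:
  assumes "Poly_Mapping.keys c \<subseteq> {..<n}"
  shows "(\<Sum>k\<in>Poly_Mapping.keys c. smult (Poly_Mapping.lookup c k) (sigma k))
       = (\<Sum>k<n. smult (Poly_Mapping.lookup c k) (sigma k))"
  using assms by (intro sum.mono_neutral_left) (auto simp: in_keys_iff)

theorem sigma_basis:
  "\<exists>!c. p = (\<Sum>k\<in>Poly_Mapping.keys c. smult (Poly_Mapping.lookup c k) (sigma k))"
proof -
  let ?f = "\<lambda>c. \<Sum>k\<in>Poly_Mapping.keys c. smult (Poly_Mapping.lookup c k) (sigma k)"
  obtain d where d: "p = (\<Sum>k<Suc (degree p). smult (d k) (sigma k))"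
    using sigma_expansion_exists[of p "Suc (degree p)"] by auto
  define c where "c = Poly_Mapping.Abs_poly_mapping (\<lambda>k. if k < Suc (degree p) then d k else 0)"
  have lc: "Poly_Mapping.lookup c k = (if k < Suc (degree p) then d k else 0)" for k
    unfolding c_def by (subst lookup_Abs_poly_mapping) (auto intro: finite_subset[of _ "{..degree p}"])
  have "Poly_Mapping.keys c \<subseteq> {..<Suc (degree p)}" by (auto simp: in_keys_iff lc split: if_splits)
  then have "p = ?f c"
    unfolding sum_keys_lessThan[OF \<open>Poly_Mapping.keys c \<subseteq> {..<Suc (degree p)}\<close>]
    by (subst d) (intro sum.cong, auto simp: lc)
  moreover have "a = b" if "?f a = ?f b" for a b
  proof -
    have "finite (Poly_Mapping.keys a \<union> Poly_Mapping.keys b)" by simp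
    then obtain n where n: "Poly_Mapping.keys a \<union> Poly_Mapping.keys b \<subseteq> {..<n}"
      unfolding finite_nat_set_iff_bounded by auto
    have "(\<Sum>k<n. smult (Poly_Mapping.lookup a k - Poly_Mapping.lookup b k) (sigma k)) = 0"
      using that n
      by (simp only: sum_keys_lessThan[of _ n] le_sup_iff smult_diff_left sum_subtractf) simp
    then have *: "Poly_Mapping.lookup a k = Poly_Mapping.lookup b k" if "k < n" for k
      using sigma_sum_eq_0[of "\<lambda>k. Poly_Mapping.lookup a k - Poly_Mapping.lookup b k" n k] that
      by simp
    show "a = b"
    proof (rule poly_mapping_eqI)
      fix k
      show "Poly_Mapping.lookup a k = Poly_Mapping.lookup b k"
      proof (cases "k < n")
        case False
        then have "k \<notin> Poly_Mapping.keys a" "k \<notin> Poly_Mapping.keys b" using n by auto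
        then show ?thesis by (simp add: in_keys_iff)
      qed (rule *)
    qed
  qed
  ultimately show ?thesis by (intro ex1I[of _ c]) auto
qed

lemma sigma_coords:
  "p = (\<Sum>k\<in>Poly_Mapping.keys (sigma_coords p).
          smult (Poly_Mapping.lookup (sigma_coords p) k) (sigma k))"
  unfolding sigma_coords_def by (rule theI'[OF sigma_basis])

lemma sigma_coords_lessThan:
  assumes "p = (\<Sum>k<n. smult (d k) (sigma k))"
  shows "Poly_Mapping.lookup (sigma_coords p) k = (if k < n then d k else 0)"
proof -
  define c where "c = Poly_Mapping.Abs_poly_mapping (\<lambda>k. if k < n then d k else 0)"
  have lc: "Poly_Mapping.lookup c k = (if k < n then d k else 0)" for k
    unfolding c_def by (subst lookup_Abs_poly_mapping) (auto intro: finite_subset[of _ "{..n}"])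
  have k: "Poly_Mapping.keys c \<subseteq> {..<n}" by (auto simp: in_keys_iff lc split: if_splits)
  have "p = (\<Sum>k\<in>Poly_Mapping.keys c. smult (Poly_Mapping.lookup c k) (sigma k))"
    unfolding sum_keys_lessThan[OF k] by (subst assms) (intro sum.cong, auto simp: lc)
  then have "sigma_coords p = c" using sigma_coords[of p] sigma_basis[of p] by metis
  then show ?thesis by (simp add: lc)
qed

lemma sigma_times_linear: "sigma k * [:mvar j, 1:] = sigma (Suc k) + smult (mvar j - mvar k) (sigma k)"
proof -
  have "[:mvar j, 1:] = [:mvar k, 1:] + [:mvar j - mvar k:]" by simp
  then show ?thesis by (simp only: sigma_Suc distrib_left) (simp add: mult.commute)
qed

lemma sigma_product_expansion:
  "\<exists>d. sigma i * sigma j = (\<Sum>k<Suc (i + j). smult (beta_to_t (d k)) (sigma k))"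
proof (induction j)
  case 0
  have "(\<Sum>k<i. smult (beta_to_t (if k = i then 1 else 0)) (sigma k)) = 0"
    by (intro sum.neutral) (simp add: beta_to_t_def)
  then have "sigma i * sigma 0 = (\<Sum>k<Suc (i + 0). smult (beta_to_t (if k = i then 1 else 0)) (sigma k))"
    by (simp add: beta_to_t_def mpoly_subst_1)
  then show ?case by (intro exI)
next
  case (Suc j)
  then obtain d where d: "sigma i * sigma j = (\<Sum>k<Suc (i + j). smult (beta_to_t (d k)) (sigma k))" ..
  define b where "b k = t_shift j - t_shift k" for k
  have b: "beta_to_t (b k) = mvar j - mvar k" for k
    using beta_to_t_shift[of j] beta_to_t_shift[of k]
    by (simp add: b_def beta_to_t_def mpoly_subst_diff)
  define u where "u k = (if k = 0 then 0 else d (k - 1))" for k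
  define v where "v k = (if k < Suc (i + j) then d k * b k else 0)" for k
  have "sigma i * sigma (Suc j) = (sigma i * sigma j) * [:mvar j, 1:]"
    by (simp only: sigma_Suc mult.assoc)
  also have "\<dots> = (\<Sum>k<Suc (i + j). smult (beta_to_t (d k)) (sigma k * [:mvar j, 1:]))"
    by (simp only: d sum_distrib_right mult_smult_left)
  also have "\<dots> = (\<Sum>k<Suc (i + j). smult (beta_to_t (d k)) (sigma (Suc k)))
               + (\<Sum>k<Suc (i + j). smult (beta_to_t (d k * b k)) (sigma k))"
    by (simp only: sigma_times_linear smult_add_right smult_smult b[symmetric] sum.distrib
        beta_to_t_def mpoly_subst_mult)
  also have "(\<Sum>k<Suc (i + j). smult (beta_to_t (d k)) (sigma (Suc k)))
           = (\<Sum>k<Suc (i + Suc j). smult (beta_to_t (u k)) (sigma k))"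
    unfolding add_Suc_right sum.lessThan_Suc_shift[of _ "Suc (i + j)"]
    by (simp add: u_def beta_to_t_def)
  also have "(\<Sum>k<Suc (i + j). smult (beta_to_t (d k * b k)) (sigma k))
           = (\<Sum>k<Suc (i + Suc j). smult (beta_to_t (v k)) (sigma k))"
    by (rule sum.mono_neutral_cong_left) (auto simp: v_def beta_to_t_def)
  also have "(\<Sum>k<Suc (i + Suc j). smult (beta_to_t (u k)) (sigma k))
           + (\<Sum>k<Suc (i + Suc j). smult (beta_to_t (v k)) (sigma k))
           = (\<Sum>k<Suc (i + Suc j). smult (beta_to_t (u k + v k)) (sigma k))"
    by (simp only: beta_to_t_def mpoly_subst_add smult_add_left sum.distrib)
  finally show ?case by (intro exI)
qed

theorem beta_to_t_struct_const: "beta_to_t (struct_const i j k) = struct_const_t i j k"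
proof -
  obtain d where "sigma i * sigma j = (\<Sum>k<Suc (i + j). smult (beta_to_t (d k)) (sigma k))"
    using sigma_product_expansion by blast
  then have "struct_const_t i j k = (if k < Suc (i + j) then beta_to_t (d k) else 0)"
    unfolding struct_const_t_def by (rule sigma_coords_lessThan)
  then have "struct_const_t i j k = beta_to_t (if k < Suc (i + j) then d k else 0)"
    by (auto simp: beta_to_t_def)
  then have "\<exists>!p. beta_to_t p = struct_const_t i j k"
    using inj_beta_to_t by (metis injD)
  then show ?thesis unfolding struct_const_def by (rule theI')
qed

theorem struct_const_product:
  "sigma i * sigma j = (\<Sum>k\<le>i + j. smult (beta_to_t (struct_const i j k)) (sigma k))"
proof -
  obtain d where d: "sigma i * sigma j = (\<Sum>k<Suc (i + j). smult (beta_to_t (d k)) (sigma k))"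
    using sigma_product_expansion by blast
  then have "struct_const_t i j k = (if k < Suc (i + j) then beta_to_t (d k) else 0)" for k
    unfolding struct_const_t_def by (rule sigma_coords_lessThan)
  then show ?thesis
    unfolding d beta_to_t_struct_const lessThan_Suc_atMost by (intro sum.cong) auto
qed

text \<open>
  Modulo \<open>\<sigma>\<^sub>n\<^sub>+\<^sub>1\<close>, i.e. in \<open>H\<^sub>T\<^sup>*(P\<^sup>n)\<close>, the structure constants with respect to
  \<open>\<sigma>\<^sub>0, \<dots>, \<sigma>\<^sub>n\<close> are unique and are the same ones.
\<close>

theorem struct_const_finite:
  "sigma (Suc n) dvd sigma i * sigma j - (\<Sum>k\<le>n. smult (c k) (sigma k))
     \<longleftrightarrow> (\<forall>k\<le>n. c k = beta_to_t (struct_const i j k))"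
proof -
  let ?C = "\<lambda>k. beta_to_t (struct_const i j k)"
  let ?M = "max n (i + j)"
  have zero: "?C k = 0" if "k > i + j" for k
  proof -
    have "sigma i * sigma j = (\<Sum>k<Suc (i + j). smult (?C k) (sigma k))"
      by (simp only: struct_const_product lessThan_Suc_atMost)
    from sigma_coords_lessThan[OF this, of k] that show ?thesis
      by (simp add: beta_to_t_struct_const struct_const_t_def)
  qed
  have "sigma i * sigma j = (\<Sum>k\<le>?M. smult (?C k) (sigma k))"
    unfolding struct_const_product by (rule sum.mono_neutral_left) (auto simp: zero)
  also have "\<dots> = (\<Sum>k\<le>n. smult (?C k) (sigma k)) + (\<Sum>k\<in>{n<..?M}. smult (?C k) (sigma k))"
    by (subst sum.union_disjoint[symmetric]) (auto intro!: sum.cong)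
  finally have split: "sigma i * sigma j
      = (\<Sum>k\<le>n. smult (?C k) (sigma k)) + (\<Sum>k\<in>{n<..?M}. smult (?C k) (sigma k))" .
  have "sigma (Suc n) dvd sigma k" if "n < k" for k
    unfolding sigma_def using that by (intro prod_dvd_prod_subset) auto
  then have tail: "sigma (Suc n) dvd (\<Sum>k\<in>{n<..?M}. smult (?C k) (sigma k))"
    by (intro dvd_sum dvd_smult) auto
  have "sigma i * sigma j - (\<Sum>k\<le>n. smult (c k) (sigma k))
      = (\<Sum>k\<le>n. smult (?C k - c k) (sigma k)) + (\<Sum>k\<in>{n<..?M}. smult (?C k) (sigma k))"
    by (simp only: split smult_diff_left sum_subtractf diff_add_eq)
  then have "sigma (Suc n) dvd sigma i * sigma j - (\<Sum>k\<le>n. smult (c k) (sigma k))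
      \<longleftrightarrow> sigma (Suc n) dvd (\<Sum>k\<le>n. smult (?C k - c k) (sigma k))"
    by (simp only:) (rule dvd_add_left_iff[OF tail])
  also have "\<dots> \<longleftrightarrow> (\<Sum>k<Suc n. smult (?C k - c k) (sigma k)) = 0"
  proof
    let ?s = "\<Sum>k\<le>n. smult (?C k - c k) (sigma k)"
    have "degree ?s < Suc n"
      using sigma_sum_degree[of "\<lambda>k. ?C k - c k" "Suc n"] by (simp only: lessThan_Suc_atMost) simp
    moreover assume "sigma (Suc n) dvd ?s"
    ultimately have "?s = 0"
      using dvd_imp_degree_le[of "sigma (Suc n)" ?s] by (fold not_less, unfold degree_sigma) blast
    then show "(\<Sum>k<Suc n. smult (?C k - c k) (sigma k)) = 0" by (simp only: lessThan_Suc_atMost)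
  qed (simp only: lessThan_Suc_atMost dvd_0_right)
  also have "\<dots> \<longleftrightarrow> (\<forall>k\<le>n. c k = ?C k)"
  proof
    assume "(\<Sum>k<Suc n. smult (?C k - c k) (sigma k)) = 0"
    then show "\<forall>k\<le>n. c k = ?C k"
      using sigma_sum_eq_0[of "\<lambda>k. ?C k - c k" "Suc n"] by (auto simp del: sum.lessThan_Suc)
  next
    assume "\<forall>k\<le>n. c k = ?C k"
    then show "(\<Sum>k<Suc n. smult (?C k - c k) (sigma k)) = 0"
      by (intro sum.neutral) simp
  qed
  finally show ?thesis .
qed

end

theory Submission
  imports Defs
begin

text \<open>
  Multiplying \<open>\<sigma>\<^sub>i \<sigma>\<^sub>j\<close> by \<open>\<zeta> + t\<^sub>i\<close> gives the recurrence
  \<open>C(i + 1, j, k) = C(i, j, k - 1) + (\<beta>\<^sub>i + \<dots> + \<beta>\<^bsub>k-1\<^esub>) C(i, j, k)\<close>, in which nothing cancels.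
  By induction on \<open>i\<close>, the support of \<open>C(i, j, k)\<close> is empty unless \<open>max i j \<le> k \<le> i + j\<close>, and then
  it consists of the vectors supported on the first \<open>k\<close> coordinates, with total \<open>i + j - k\<close>, whose
  first \<open>m\<close> entries sum to at most \<open>m\<close>, for every \<open>m\<close>.  Block sums of such vectors for
  \<open>(Ni, Nj, Nk)\<close> are the vectors with total \<open>N (i + j - k)\<close> whose first \<open>m\<close> entries sum to at most
  \<open>N m\<close>; these are the sums of \<open>N\<close> vectors of the support for \<open>(i, j, k)\<close>, because rounding down the
  partial sums divided by \<open>N\<close> splits off one summand.
\<close>

subsection \<open>Polynomials with nonnegative coefficients\<close>

definition nonneg_coeffs :: "('a \<Rightarrow>\<^sub>0 int) \<Rightarrow> bool" where
  "nonneg_coeffs p \<longleftrightarrow> (\<forall>e. 0 \<le> Poly_Mapping.lookup p e)"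

lemma nonneg_coeffs_0 [simp]: "nonneg_coeffs 0"
  by (simp add: nonneg_coeffs_def)

lemma nonneg_coeffs_single: "0 \<le> c \<Longrightarrow> nonneg_coeffs (Poly_Mapping.single e c)"
  by (simp add: nonneg_coeffs_def lookup_single when_def)

lemma nonneg_coeffs_1 [simp]: "nonneg_coeffs (1 :: 'a::zero \<Rightarrow>\<^sub>0 int)"
  using nonneg_coeffs_single[of 1 "0::'a"] by simp

lemma nonneg_coeffs_add: "nonneg_coeffs p \<Longrightarrow> nonneg_coeffs q \<Longrightarrow> nonneg_coeffs (p + q)"
  by (simp add: nonneg_coeffs_def lookup_add)

lemma nonneg_coeffs_sum: "(\<And>x. x \<in> A \<Longrightarrow> nonneg_coeffs (f x)) \<Longrightarrow> nonneg_coeffs (sum f A)"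
  by (induction A rule: infinite_finite_induct) (auto intro: nonneg_coeffs_add)

lemma nonneg_coeffs_mult:
  fixes p q :: "'a::monoid_add \<Rightarrow>\<^sub>0 int"
  assumes "nonneg_coeffs p" "nonneg_coeffs q"
  shows "nonneg_coeffs (p * q)"
  using assms unfolding nonneg_coeffs_def lookup_mult Sum_any.expand_set
  by (auto intro!: sum_nonneg mult_nonneg_nonneg simp: when_def)

lemma nonneg_coeffs_power:
  "nonneg_coeffs p \<Longrightarrow> nonneg_coeffs ((p :: 'a::comm_monoid_add \<Rightarrow>\<^sub>0 int) ^ n)"
  by (induction n) (auto intro: nonneg_coeffs_mult)

lemma keys_add_nonneg:
  assumes "nonneg_coeffs p" "nonneg_coeffs q"
  shows "Poly_Mapping.keys (p + q) = Poly_Mapping.keys p \<union> Poly_Mapping.keys q"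
  using assms by (auto simp: nonneg_coeffs_def in_keys_iff lookup_add add_nonneg_eq_0_iff)

lemma keys_sum_nonneg:
  assumes "finite A" "\<And>x. x \<in> A \<Longrightarrow> nonneg_coeffs (f x)"
  shows "Poly_Mapping.keys (sum f A) = (\<Union>x\<in>A. Poly_Mapping.keys (f x))"
  using assms by (induction rule: finite_induct) (auto simp: keys_add_nonneg nonneg_coeffs_sum)

text \<open>For the inclusion that fails in general, the term of \<open>p * q\<close> coming from
  \<open>a\<close> and \<open>b\<close> is split off. What remains is a sum of products of
  nonnegative polynomials, so it cannot cancel that term.\<close>

lemma keys_mult_nonneg:
  fixes p q :: "'a::monoid_add \<Rightarrow>\<^sub>0 int"
  assumes "nonneg_coeffs p" "nonneg_coeffs q"
  shows "Poly_Mapping.keys (p * q)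
       = {a + b | a b. a \<in> Poly_Mapping.keys p \<and> b \<in> Poly_Mapping.keys q}"
proof (intro subset_antisym keys_mult subsetI)
  fix e assume "e \<in> {a + b | a b. a \<in> Poly_Mapping.keys p \<and> b \<in> Poly_Mapping.keys q}"
  then obtain a b where e: "e = a + b" and ab: "a \<in> Poly_Mapping.keys p" "b \<in> Poly_Mapping.keys q"
    by blast
  define x y where "x = Poly_Mapping.lookup p a" and "y = Poly_Mapping.lookup q b"
  have xy: "0 < x" "0 < y"
    using assms ab by (auto simp: x_def y_def nonneg_coeffs_def in_keys_iff less_le)
  define p' q' where "p' = p - Poly_Mapping.single a x" and "q' = q - Poly_Mapping.single b y"
  have nn: "nonneg_coeffs p'" "nonneg_coeffs q'"
    using assms
    by (simp_all add: p'_def q'_def x_def y_def nonneg_coeffs_def lookup_minus lookup_single when_def)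
  have "p * q = Poly_Mapping.single e (x * y) + (Poly_Mapping.single a x * q' + p' * q)"
    by (simp add: p'_def q'_def e left_diff_distrib right_diff_distrib mult_single)
  moreover have "nonneg_coeffs (Poly_Mapping.single a x * q' + p' * q)"
    using nn assms xy by (intro nonneg_coeffs_add nonneg_coeffs_mult nonneg_coeffs_single) auto
  moreover have "nonneg_coeffs (Poly_Mapping.single e (x * y))"
    using xy by (intro nonneg_coeffs_single) simp
  ultimately show "e \<in> Poly_Mapping.keys (p * q)"
    using xy by (simp add: keys_add_nonneg)
qed


subsection \<open>Exponent vectors with bounded partial sums\<close>

text \<open>The slope \<open>N\<close> is a parameter so that one family covers both sides: slope 1
  describes a structure constant, slope \<open>N\<close> its \<open>N\<close>-th power and also the
  block sums.\<close>

definition ballot :: "nat \<Rightarrow> nat \<Rightarrow> nat \<Rightarrow> (nat \<Rightarrow>\<^sub>0 nat) set" where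
  "ballot N k d = {e. Poly_Mapping.keys e \<subseteq> {..<k} \<and> (\<Sum>m<k. Poly_Mapping.lookup e m) = d
                      \<and> (\<forall>m. (\<Sum>l<m. Poly_Mapping.lookup e l) \<le> N * m)}"

lemma keys_subset_lessThan_iff:
  "Poly_Mapping.keys e \<subseteq> {..<k :: 'a::linorder} \<longleftrightarrow> (\<forall>m\<ge>k. Poly_Mapping.lookup e m = 0)"
  by (auto simp: subset_iff in_keys_iff simp flip: not_le)

lemma sum_lookup_lessThan_le:
  assumes "Poly_Mapping.keys e \<subseteq> {..<k}"
  shows "(\<Sum>l<m. Poly_Mapping.lookup e l) \<le> (\<Sum>l<k. Poly_Mapping.lookup (e :: nat \<Rightarrow>\<^sub>0 nat) l)"
proof -
  have "(\<Sum>l<m. Poly_Mapping.lookup e l) = (\<Sum>l\<in>{..<m} \<inter> {..<k}. Poly_Mapping.lookup e l)"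
    using assms by (intro sum.mono_neutral_right) (auto simp: keys_subset_lessThan_iff not_less[symmetric])
  also have "\<dots> \<le> (\<Sum>l<k. Poly_Mapping.lookup e l)"
    by (intro sum_mono2) auto
  finally show ?thesis .
qed

lemma sum_lookup_extend:
  assumes "Poly_Mapping.keys e \<subseteq> {..<k}" "k \<le> k'"
  shows "(\<Sum>l<k'. Poly_Mapping.lookup e l) = (\<Sum>l<k. Poly_Mapping.lookup (e :: nat \<Rightarrow>\<^sub>0 nat) l)"
  using assms by (intro sum.mono_neutral_right) (auto simp: in_keys_iff)

lemma ballot_0: "ballot N k 0 = {0}"
proof -
  have "e = 0" if "e \<in> ballot N k 0" for e
  proof (rule poly_mapping_eqI)
    fix m
    show "Poly_Mapping.lookup e m = Poly_Mapping.lookup 0 m"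
      using that by (cases "m < k") (auto simp: ballot_def in_keys_iff)
  qed
  then show ?thesis by (auto simp: ballot_def)
qed

lemma ballot_add:
  assumes "x \<in> ballot M k c" "y \<in> ballot N k d"
  shows "x + y \<in> ballot (M + N) k (c + d)"
proof -
  have "Poly_Mapping.keys (x + y) \<subseteq> {..<k}"
    using Poly_Mapping.keys_add[of x y] assms by (auto simp: ballot_def)
  then show ?thesis
    using assms by (auto simp: ballot_def lookup_add sum.distrib add_mult_distrib intro: add_mono)
qed

text \<open>The summand \<open>x\<close> has partial sums \<open>\<lfloor>Y\<^sub>q / (N + 1)\<rfloor>\<close>, where \<open>Y\<^sub>q\<close> are those of \<open>y\<close>.\<close>

lemma ballot_decompose:
  assumes y: "y \<in> ballot (Suc N) k (Suc N * d)"
  obtains x z where "y = x + z" "x \<in> ballot 1 k d" "z \<in> ballot N k (N * d)"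
proof -
  define Y where "Y q = (\<Sum>l<q. Poly_Mapping.lookup y l)" for q
  have Y_Suc: "Y (Suc q) = Y q + Poly_Mapping.lookup y q" for q by (simp add: Y_def)
  have Y_le: "Y q \<le> Suc N * q" and Yk: "Y k = Suc N * d" for q
    using y by (simp_all only: ballot_def Y_def mem_Collect_eq)
  have zero: "Poly_Mapping.lookup y q = 0" if "k \<le> q" for q
    using y that by (simp add: ballot_def keys_subset_lessThan_iff)
  define f where "f q = Y (Suc q) div Suc N - Y q div Suc N" for q
  have mono: "Y q div Suc N \<le> Y (Suc q) div Suc N" for q
    by (intro div_le_mono) (simp add: Y_Suc)
  define x where "x = Poly_Mapping.Abs_poly_mapping f"
  have f0: "f q = 0" if "k \<le> q" for q using zero[OF that] by (simp add: f_def Y_Suc)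
  then have "{q. f q \<noteq> 0} \<subseteq> {..<k}"
    by (metis (mono_tags) lessThan_iff mem_Collect_eq not_le subsetI)
  then have "finite {q. f q \<noteq> 0}" by (rule finite_subset) simp
  then have lx: "Poly_Mapping.lookup x = f" by (simp add: x_def)
  have X: "(\<Sum>l<q. f l) = Y q div Suc N" for q
  proof (induction q)
    case (Suc q)
    then show ?case using mono[of q] by (simp add: f_def)
  qed (simp add: Y_def)
  \<comment> \<open>Raising \<open>Y q\<close> by \<open>Suc N\<close> times an entry raises the
    quotient by exactly that entry. The bound keeps the truncated subtraction in \<open>z\<close>
    from losing anything.\<close>
  have f_le: "f q \<le> Poly_Mapping.lookup y q" for q
  proof -
    have "Y (Suc q) div Suc N \<le> (Y q + Poly_Mapping.lookup y q * Suc N) div Suc N"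
      unfolding Y_Suc by (intro div_le_mono) simp
    also have "\<dots> = Y q div Suc N + Poly_Mapping.lookup y q"
      by (simp only: div_mult_self1 nat.distinct simp_thms)
    finally show ?thesis by (simp add: f_def)
  qed
  define z where "z = y - x"
  have lz: "Poly_Mapping.lookup z q = Poly_Mapping.lookup y q - f q" for q
    by (simp add: z_def lookup_minus lx)
  have "(\<Sum>l<q. Poly_Mapping.lookup z l) + (\<Sum>l<q. f l) = Y q" for q
    unfolding Y_def sum.distrib[symmetric] lz using f_le by (intro sum.cong) auto
  then have Z: "(\<Sum>l<q. Poly_Mapping.lookup z l) + Y q div Suc N = Y q" for q
    by (simp only: X)
  have Z_le: "(\<Sum>l<q. Poly_Mapping.lookup z l) \<le> N * q" for q
  proof -
    define a r where "a = Y q div Suc N" and "r = Y q mod Suc N"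
    have Yar: "Y q = Suc N * a + r" unfolding a_def r_def by (simp only: mult_div_mod_eq)
    have r: "r \<le> N" by (simp add: r_def less_Suc_eq_le[symmetric])
    have Zq: "(\<Sum>l<q. Poly_Mapping.lookup z l) = N * a + r"
      using Z[of q, folded a_def] Yar by simp
    have aq: "a \<le> q" unfolding a_def using Y_le[of q]
      by (metis div_le_mono nonzero_mult_div_cancel_left nat.distinct(1))
    show ?thesis
    \<comment> \<open>If \<open>a = q\<close>, the bound on \<open>Y q\<close> leaves no remainder.
      Otherwise \<open>r \<le> N\<close> is absorbed by the step from \<open>a\<close> to
      \<open>Suc a\<close>, which is still at most \<open>q\<close>.\<close>
    proof (cases "a = q")
      case True
      then have "r = 0" using Y_le[of q] Yar by simp
      then show ?thesis using Zq True by simp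
    next
      case False
      then have "N * Suc a \<le> N * q" using aq by (intro mult_le_mono2) simp
      then show ?thesis using Zq r by simp
    qed
  qed
  show thesis
  proof (rule that)
    show "y = x + z"
      using f_le by (intro poly_mapping_eqI) (simp add: lookup_add lx lz)
    have "Y q div Suc N \<le> q" for q using Y_le[of q]
      by (metis div_le_mono nonzero_mult_div_cancel_left nat.distinct(1))
    moreover have "Y k div Suc N = d" unfolding Yk by (rule nonzero_mult_div_cancel_left) simp
    ultimately show "x \<in> ballot 1 k d"
      using f0 by (simp add: ballot_def keys_subset_lessThan_iff lx X)
    have "(\<Sum>l<k. Poly_Mapping.lookup z l) = N * d"
      using Z[of k] \<open>Y k div Suc N = d\<close> Yk by simp
    then show "z \<in> ballot N k (N * d)"
      using Z_le zero by (simp add: ballot_def keys_subset_lessThan_iff lz)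
  qed
qed

text \<open>Induction on the exponent: nonnegativity turns the support of a product into a sumset,
  and \<open>ballot_add\<close> and \<open>ballot_decompose\<close> give its two inclusions.\<close>

lemma keys_power_ballot:
  fixes p :: int_mpoly
  assumes "nonneg_coeffs p" "Poly_Mapping.keys p = ballot 1 k d"
  shows "Poly_Mapping.keys (p ^ N) = ballot N k (N * d)"
proof (induction N)
  case 0
  show ?case by (simp add: ballot_0)
next
  case (Suc N)
  have "Poly_Mapping.keys (p ^ Suc N) = {x + z | x z. x \<in> ballot 1 k d \<and> z \<in> ballot N k (N * d)}"
    using assms by (simp add: keys_mult_nonneg nonneg_coeffs_power Suc.IH)
  also have "\<dots> = ballot (Suc N) k (Suc N * d)"
  proof safe
    fix x z assume "x \<in> ballot 1 k d" "z \<in> ballot N k (N * d)"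
    then show "x + z \<in> ballot (Suc N) k (Suc N * d)"
      using ballot_add[of x 1 k d z N "N * d"] by simp
  next
    fix y assume "y \<in> ballot (Suc N) k (Suc N * d)"
    then obtain x z where "y = x + z" "x \<in> ballot 1 k d" "z \<in> ballot N k (N * d)"
      by (rule ballot_decompose)
    then show "\<exists>x z. y = x + z \<and> x \<in> ballot 1 k d \<and> z \<in> ballot N k (N * d)" by blast
  qed
  finally show ?case .
qed

section \<open>Block sums of exponent vectors\<close>

definition block_sum :: "nat \<Rightarrow> (nat \<Rightarrow>\<^sub>0 nat) \<Rightarrow> (nat \<Rightarrow>\<^sub>0 nat)" where
  "block_sum N e = Poly_Mapping.Abs_poly_mapping
     (\<lambda>q. \<Sum>m = q * N..<q * N + N. Poly_Mapping.lookup e m)"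

lemma lookup_block_sum:
  "Poly_Mapping.lookup (block_sum N e) q = (\<Sum>m = q * N..<q * N + N. Poly_Mapping.lookup e m)"
proof -
  have "{q. (\<Sum>m = q * N..<q * N + N. Poly_Mapping.lookup e m) \<noteq> 0}
      \<subseteq> (\<lambda>m. m div N) ` Poly_Mapping.keys e"
  proof
    fix q assume "q \<in> {q. (\<Sum>m = q * N..<q * N + N. Poly_Mapping.lookup e m) \<noteq> 0}"
    then obtain m where m: "m \<in> {q * N..<q * N + N}" "Poly_Mapping.lookup e m \<noteq> 0"
      by (auto elim: sum.not_neutral_contains_not_neutral)
    then have "m div N = q" by (intro div_nat_eqI) (auto simp: mult.commute)
    then show "q \<in> (\<lambda>m. m div N) ` Poly_Mapping.keys e" using m by (auto simp: in_keys_iff)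
  qed
  then have "finite {q. (\<Sum>m = q * N..<q * N + N. Poly_Mapping.lookup e m) \<noteq> 0}"
    by (rule finite_subset) simp
  then show ?thesis by (simp add: block_sum_def)
qed

text \<open>This is how slope 1 becomes slope \<open>N\<close>: the bound at index
  \<open>q * N\<close> is read as a bound at index \<open>q\<close>.\<close>

lemma sum_block_sum:
  "(\<Sum>l<q. Poly_Mapping.lookup (block_sum N e) l) = (\<Sum>m<q * N. Poly_Mapping.lookup e m)"
  by (simp add: lookup_block_sum sum.nat_group)

text \<open>A preimage of \<open>y\<close> puts each entry at the last index of its block, where the bound on
  partial sums is weakest.\<close>

lemma block_sum_ballot:
  assumes "N \<ge> 1"
  shows "block_sum N ` ballot 1 (N * k) d = ballot N k d"
proof (intro subset_antisym subsetI)
  fix y assume "y \<in> block_sum N ` ballot 1 (N * k) d"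
  then obtain e where y: "y = block_sum N e" and e: "e \<in> ballot 1 (N * k) d" by blast
  have "Poly_Mapping.lookup y q = 0" if "k \<le> q" for q
  proof -
    have "Poly_Mapping.lookup e m = 0" if "q * N \<le> m" for m
    proof -
      have "k * N \<le> q * N" using \<open>k \<le> q\<close> by (rule mult_le_mono1)
      then have "N * k \<le> m" using that by (simp only: mult.commute)
      then show ?thesis using e by (simp add: ballot_def keys_subset_lessThan_iff)
    qed
    then show ?thesis by (simp add: y lookup_block_sum)
  qed
  then have "Poly_Mapping.keys y \<subseteq> {..<k}" by (simp add: keys_subset_lessThan_iff)
  with e show "y \<in> ballot N k d"
    by (auto simp: ballot_def y sum_block_sum mult.commute)
next
  fix y assume y: "y \<in> ballot N k d"
  define f where "f m = (if Suc m mod N = 0 then Poly_Mapping.lookup y (m div N) else 0)" for m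
  define x where "x = Poly_Mapping.Abs_poly_mapping f"
  have f0: "f m = 0" if "N * k \<le> m" for m
  proof -
    have "k \<le> m div N" using that assms by (simp add: less_eq_div_iff_mult_less_eq mult.commute)
    then show ?thesis using y by (simp add: f_def ballot_def keys_subset_lessThan_iff)
  qed
  then have "{m. f m \<noteq> 0} \<subseteq> {..<N * k}"
    by (metis (mono_tags) lessThan_iff mem_Collect_eq not_le subsetI)
  then have "finite {m. f m \<noteq> 0}" by (rule finite_subset) simp
  then have lx: "Poly_Mapping.lookup x = f" by (simp add: x_def)
  \<comment> \<open>An entry of \<open>y\<close> is counted only once its block is complete, which
    is exactly when \<open>m div N\<close> increases.\<close>
  have prefix: "(\<Sum>l<m. f l) = (\<Sum>q<m div N. Poly_Mapping.lookup y q)" for m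
  proof (induction m)
    case (Suc m)
    then show ?case by (auto simp: f_def div_Suc)
  qed simp
  have "Poly_Mapping.lookup (block_sum N x) q = Poly_Mapping.lookup y q" for q
  proof -
    have "(\<Sum>l<Suc q. Poly_Mapping.lookup (block_sum N x) l)
        = (\<Sum>l<Suc q. Poly_Mapping.lookup y l)" for q
      unfolding sum_block_sum lx prefix using assms by simp
    moreover have "(\<Sum>l<q. Poly_Mapping.lookup (block_sum N x) l) = (\<Sum>l<q. Poly_Mapping.lookup y l)"
      unfolding sum_block_sum lx prefix using assms by simp
    ultimately show ?thesis by (metis add_left_cancel sum.lessThan_Suc)
  qed
  then have "block_sum N x = y" by (rule poly_mapping_eqI)
  moreover have "x \<in> ballot 1 (N * k) d"
  proof -
    have "Poly_Mapping.keys x \<subseteq> {..<N * k}"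
      using f0 by (simp add: keys_subset_lessThan_iff lx)
    moreover have "(\<Sum>m<N * k. f m) = d"
      unfolding prefix using assms y by (simp add: ballot_def)
    moreover have "(\<Sum>l<m. f l) \<le> 1 * m" for m
    proof -
      have "(\<Sum>l<m. f l) \<le> N * (m div N)" unfolding prefix using y by (simp add: ballot_def)
      also have "\<dots> \<le> m" by simp
      finally show ?thesis by simp
    qed
    ultimately show ?thesis by (simp add: ballot_def lx)
  qed
  ultimately show "y \<in> block_sum N ` ballot 1 (N * k) d" by blast
qed

lemma block_proj_Supp:
  "block_proj N ` Supp p
     = (\<lambda>e m. real (Poly_Mapping.lookup e m)) ` block_sum N ` Poly_Mapping.keys p"
  by (auto simp: Supp_def image_image block_proj_def lookup_block_sum add.commute intro!: image_cong)


subsection \<open>The support of the structure constants\<close>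

text \<open>Uniqueness of coordinates in the basis \<open>sigma\<close> and injectivity of
  \<open>beta_to_t\<close> let the constants be read off from any such expansion.\<close>

lemma struct_const_eqI:
  assumes "sigma i * sigma j = (\<Sum>k<n. smult (beta_to_t (d k)) (sigma k))"
  shows "struct_const i j k = (if k < n then d k else 0)"
proof -
  have "struct_const_t i j k = (if k < n then beta_to_t (d k) else 0)"
    unfolding struct_const_t_def by (rule sigma_coords_lessThan[OF assms])
  then have "beta_to_t (struct_const i j k) = beta_to_t (if k < n then d k else 0)"
    unfolding beta_to_t_struct_const by (auto simp: beta_to_t_def)
  then show ?thesis by (rule injD[OF inj_beta_to_t])
qed

lemma struct_const_eq_0: "i + j < k \<Longrightarrow> struct_const i j k = 0"
  using struct_const_eqI[of i j "struct_const i j" "Suc (i + j)" k] struct_const_product[of i j]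
  by (simp only: lessThan_Suc_atMost) simp

lemma struct_const_0: "struct_const 0 j k = (if k = j then 1 else 0)"
proof -
  have "sigma 0 * sigma j
      = (\<Sum>k<Suc j. smult (beta_to_t (if k = j then 1 else 0)) (sigma k))"
    by (simp add: beta_to_t_def mpoly_subst_1)
  from struct_const_eqI[OF this, of k] show ?thesis by auto
qed

text \<open>Each \<open>sigma k\<close> is multiplied by the linear factor through
  \<open>sigma_times_linear\<close>. The difference of \<open>t_shift\<close> values is the preimage
  of \<open>mvar i - mvar k\<close> under \<open>beta_to_t\<close>: both values are off by the same
  \<open>mvar 0\<close>, which cancels.\<close>

lemma struct_const_Suc:
  "struct_const (Suc i) j k
     = (if k = 0 then 0 else struct_const i j (k - 1))
       + (t_shift i - t_shift k) * struct_const i j k"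
proof -
  let ?d = "struct_const i j" and ?n = "Suc (i + j)"
  define b where "b k = t_shift i - t_shift k" for k
  have b: "beta_to_t (b k) = mvar i - mvar k" for k
    using beta_to_t_shift[of i] beta_to_t_shift[of k]
    by (simp add: b_def beta_to_t_def mpoly_subst_diff)
  define u where "u k = (if k = 0 then 0 else ?d (k - 1))" for k
  define v where "v k = b k * ?d k" for k
  have "sigma (Suc i) * sigma j = (sigma i * sigma j) * [:mvar i, 1:]"
    by (simp only: sigma_Suc mult_ac)
  also have "\<dots> = (\<Sum>k<?n. smult (beta_to_t (?d k)) (sigma k * [:mvar i, 1:]))"
    by (simp only: struct_const_product lessThan_Suc_atMost sum_distrib_right mult_smult_left)
  also have "\<dots> = (\<Sum>k<?n. smult (beta_to_t (?d k)) (sigma (Suc k)))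
               + (\<Sum>k<?n. smult (beta_to_t (?d k * b k)) (sigma k))"
    by (simp only: sigma_times_linear smult_add_right smult_smult b[symmetric] sum.distrib
        beta_to_t_def mpoly_subst_mult)
  also have "(\<Sum>k<?n. smult (beta_to_t (?d k)) (sigma (Suc k)))
           = (\<Sum>k<Suc ?n. smult (beta_to_t (u k)) (sigma k))"
    unfolding sum.lessThan_Suc_shift[of _ ?n] by (simp add: u_def beta_to_t_def)
  \<comment> \<open>Lengthening the range by one index is harmless, as
    \<open>struct_const i j k\<close> vanishes for \<open>k > i + j\<close>.\<close>
  also have "(\<Sum>k<?n. smult (beta_to_t (?d k * b k)) (sigma k))
           = (\<Sum>k<Suc ?n. smult (beta_to_t (v k)) (sigma k))"
    by (rule sum.mono_neutral_cong_left)
       (auto simp: v_def mult.commute struct_const_eq_0 beta_to_t_def)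
  also have "(\<Sum>k<Suc ?n. smult (beta_to_t (u k)) (sigma k))
           + (\<Sum>k<Suc ?n. smult (beta_to_t (v k)) (sigma k))
           = (\<Sum>k<Suc ?n. smult (beta_to_t (u k + v k)) (sigma k))"
    by (simp only: beta_to_t_def mpoly_subst_add smult_add_left sum.distrib)
  finally have "struct_const (Suc i) j k = (if k < Suc ?n then u k + v k else 0)"
    by (rule struct_const_eqI)
  moreover have "u k + v k = 0" if "\<not> k < Suc ?n"
    using that by (simp add: u_def v_def struct_const_eq_0)
  ultimately have "struct_const (Suc i) j k = u k + v k" by auto
  then show ?thesis by (simp add: u_def v_def b_def)
qed

text \<open>This is the source of positivity: for \<open>i \<le> k\<close> the factor in the
  recurrence is a sum of variables.\<close>

lemma t_shift_diff: "i \<le> k \<Longrightarrow> t_shift i - t_shift k = (\<Sum>l = i..<k. mvar l)"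
  by (simp add: t_shift_def sum_diff_nat_ivl[of 0 i k mvar, symmetric] atLeast0LessThan)

lemma nonneg_coeffs_sum_mvar: "nonneg_coeffs (\<Sum>l\<in>A. mvar l)"
  by (intro nonneg_coeffs_sum) (simp add: mvar_def nonneg_coeffs_single)

lemma keys_sum_mvar:
  "finite A \<Longrightarrow> Poly_Mapping.keys (\<Sum>l\<in>A. mvar l) = (\<lambda>l. Poly_Mapping.single l 1) ` A"
  by (subst keys_sum_nonneg) (auto simp: mvar_def nonneg_coeffs_single)

section \<open>The recurrence for the support sets\<close>

definition supp_set :: "nat \<Rightarrow> nat \<Rightarrow> nat \<Rightarrow> (nat \<Rightarrow>\<^sub>0 nat) set" where
  "supp_set i j k = (if i \<le> k \<and> j \<le> k \<and> k \<le> i + j then ballot 1 k (i + j - k) else {})"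

lemma supp_set_Suc_step1:
  assumes "0 < k" "x \<in> supp_set i j (k - 1)"
  shows "x \<in> supp_set (Suc i) j k"
proof -
  have *: "i \<le> k - 1" "j \<le> k - 1" "k - 1 \<le> i + j" and x: "x \<in> ballot 1 (k - 1) (i + j - (k - 1))"
    using assms(2) by (auto simp: supp_set_def split: if_splits)
  have "(\<Sum>m<k. Poly_Mapping.lookup x m) = Suc (i + j) - k"
    using x sum_lookup_extend[of x "k - 1" k] assms(1) by (auto simp: ballot_def)
  moreover have "Poly_Mapping.keys x \<subseteq> {..<k}" using x by (auto simp: ballot_def)
  ultimately show ?thesis using * x assms(1) by (auto simp: supp_set_def ballot_def)
qed

lemma sum_lookup_single:
  "(\<Sum>m<n::nat. Poly_Mapping.lookup (Poly_Mapping.single b (1::nat)) m) = (if b < n then 1 else 0)"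
  by (induction n) (auto simp: lookup_single when_def)

lemma supp_set_Suc_step2:
  assumes "i \<le> b" "b < k" "x \<in> supp_set i j k"
  shows "Poly_Mapping.single b 1 + x \<in> supp_set (Suc i) j k"
proof -
  let ?y = "Poly_Mapping.single b 1 + x"
  have *: "j \<le> k" "k \<le> i + j" and x: "x \<in> ballot 1 k (i + j - k)"
    using assms(3) by (auto simp: supp_set_def split: if_splits)
  have keys: "Poly_Mapping.keys ?y \<subseteq> {..<k}"
    using Poly_Mapping.keys_add[of "Poly_Mapping.single b 1" x] x assms(2)
    by (auto simp: ballot_def split: if_splits)
  have prefix: "(\<Sum>l<m. Poly_Mapping.lookup ?y l)
      = (if b < m then 1 else 0) + (\<Sum>l<m. Poly_Mapping.lookup x l)" for m
    unfolding lookup_add sum.distrib sum_lookup_single ..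
  have total: "(\<Sum>l<k. Poly_Mapping.lookup ?y l) = Suc i + j - k"
    unfolding prefix using x assms(2) * by (simp add: ballot_def)
  have "(\<Sum>l<m. Poly_Mapping.lookup ?y l) \<le> 1 * m" for m
  proof (cases "b < m")
    case True
    \<comment> \<open>Past position \<open>b\<close> the total alone suffices: by
      \<open>j \<le> k\<close> it is at most \<open>Suc i\<close>, and
      \<open>Suc i \<le> Suc b \<le> m\<close>.\<close>
    have "(\<Sum>l<m. Poly_Mapping.lookup ?y l) \<le> Suc i + j - k"
      using sum_lookup_lessThan_le[OF keys] total by metis
    then show ?thesis using True assms(1) * by linarith
  next
    case False
    then show ?thesis unfolding prefix using x by (simp add: ballot_def)
  qed
  then show ?thesis using keys total * assms by (simp add: supp_set_def ballot_def)
qed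

text \<open>A nonzero entry at some \<open>b \<ge> i\<close> can be lowered by one, which gives the
  second alternative. Without such an entry, \<open>y\<close> lives on the first \<open>i\<close>
  coordinates and belongs to \<open>k - 1\<close>.\<close>

lemma supp_set_Suc_cases:
  assumes y: "y \<in> supp_set (Suc i) j k"
  shows "0 < k \<and> y \<in> supp_set i j (k - 1)
       \<or> (\<exists>b\<in>{i..<k}. \<exists>x\<in>supp_set i j k. y = Poly_Mapping.single b 1 + x)"
proof -
  have *: "Suc i \<le> k" "j \<le> k" "k \<le> Suc i + j" and yb: "y \<in> ballot 1 k (Suc i + j - k)"
    using y by (auto simp: supp_set_def split: if_splits)
  have keys: "Poly_Mapping.keys y \<subseteq> {..<k}"
    and total: "(\<Sum>m<k. Poly_Mapping.lookup y m) = Suc i + j - k"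
    and prefix: "(\<Sum>l<m. Poly_Mapping.lookup y l) \<le> m" for m
    using yb by (auto simp: ballot_def)
  show ?thesis
  proof (cases "\<exists>b\<ge>i. Poly_Mapping.lookup y b \<noteq> 0")
    case True
    then obtain b where b: "i \<le> b" "Poly_Mapping.lookup y b \<noteq> 0" by blast
    then have bk: "b < k" using keys by (meson in_keys_iff lessThan_iff subsetD)
    define x where "x = y - Poly_Mapping.single b 1"
    have yx: "y = Poly_Mapping.single b 1 + x"
      using b by (intro poly_mapping_eqI) (auto simp: x_def lookup_add lookup_minus lookup_single when_def)
    have pre: "(\<Sum>l<m. Poly_Mapping.lookup y l)
        = (if b < m then 1 else 0) + (\<Sum>l<m. Poly_Mapping.lookup x l)" for m
      unfolding yx lookup_add sum.distrib sum_lookup_single ..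
    have "Poly_Mapping.keys x \<subseteq> {..<k}"
      using keys by (simp add: x_def keys_subset_lessThan_iff lookup_minus)
    \<comment> \<open>The successor on the left makes the difference positive, hence
      \<open>k \<le> i + j\<close>, as \<open>supp_set i j k\<close> demands.\<close>
    moreover have t: "Suc (\<Sum>m<k. Poly_Mapping.lookup x m) = Suc i + j - k"
      using pre[of k] total bk by simp
    moreover have "(\<Sum>l<m. Poly_Mapping.lookup x l) \<le> m" for m
      using pre[of m] prefix[of m] by simp
    ultimately have "x \<in> supp_set i j k"
      using * by (auto simp: supp_set_def ballot_def)
    then show ?thesis using yx b bk by auto
  next
    case False
    then have keys_i: "Poly_Mapping.keys y \<subseteq> {..<i}"
      by (simp add: keys_subset_lessThan_iff)
    have ti: "(\<Sum>m<i. Poly_Mapping.lookup y m) = Suc i + j - k"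
      using sum_lookup_extend[OF keys_i, of k] * total by simp
    \<comment> \<open>The whole total sits in the first \<open>i\<close> entries and is therefore at
      most \<open>i\<close>. This excludes \<open>j = k\<close>, so that
      \<open>j \<le> k - 1\<close>.\<close>
    then have jk: "j < k" using prefix[of i] * by linarith
    have "(\<Sum>m<k-1. Poly_Mapping.lookup y m) = i + j - (k - 1)"
      using sum_lookup_extend[OF keys_i, of "k - 1"] * ti by simp
    moreover have "Poly_Mapping.keys y \<subseteq> {..<k - 1}" using keys_i * by fastforce
    ultimately have "y \<in> supp_set i j (k - 1)"
      using * jk prefix by (auto simp: supp_set_def ballot_def)
    then show ?thesis using * by auto
  qed
qed

lemma supp_set_Suc:
  "supp_set (Suc i) j k
     = (if k = 0 then {} else supp_set i j (k - 1))
       \<union> {a + b | a b. a \<in> (\<lambda>l. Poly_Mapping.single l 1) ` {i..<k} \<and> b \<in> supp_set i j k}"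
    (is "_ = ?U \<union> ?V")
proof (intro subset_antisym subsetI)
  fix y assume "y \<in> supp_set (Suc i) j k"
  from supp_set_Suc_cases[OF this] show "y \<in> ?U \<union> ?V" by auto
next
  fix y assume "y \<in> ?U \<union> ?V"
  then show "y \<in> supp_set (Suc i) j k"
    using supp_set_Suc_step1[of k y i j] supp_set_Suc_step2[of i _ k _ j] by (auto split: if_splits)
qed

text \<open>Positivity rules out cancellation, so the recurrence determines the support.\<close>

lemma struct_const_nonneg_keys:
  "nonneg_coeffs (struct_const i j k) \<and> Poly_Mapping.keys (struct_const i j k) = supp_set i j k"
proof (induction i arbitrary: k)
  case 0
  show ?case by (auto simp: struct_const_0 supp_set_def ballot_0)
next
  case (Suc i)
  define L :: int_mpoly where "L = (\<Sum>l = i..<k. mvar l)"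
  have L: "nonneg_coeffs L" "Poly_Mapping.keys L = (\<lambda>l. Poly_Mapping.single l 1) ` {i..<k}"
    unfolding L_def by (simp_all add: nonneg_coeffs_sum_mvar keys_sum_mvar)
  define u where "u = (if k = 0 then 0 else struct_const i j (k - 1))"
  have u: "nonneg_coeffs u" "Poly_Mapping.keys u = (if k = 0 then {} else supp_set i j (k - 1))"
    using Suc.IH by (auto simp: u_def)
  \<comment> \<open>For \<open>k < i\<close> the factor on the left is not a sum of variables, but
    there the structure constant is zero by induction.\<close>
  have "(t_shift i - t_shift k) * struct_const i j k = L * struct_const i j k"
  proof (cases "i \<le> k")
    case False
    then have "supp_set i j k = {}" by (simp add: supp_set_def)
    then have "struct_const i j k = 0" using Suc.IH[of k] keys_eq_empty by metis
    then show ?thesis by simp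
  qed (simp add: L_def t_shift_diff)
  then have "struct_const (Suc i) j k = u + L * struct_const i j k"
    by (simp add: struct_const_Suc u_def)
  then show ?case
    using L u Suc.IH[of k]
    by (simp add: nonneg_coeffs_add nonneg_coeffs_mult keys_add_nonneg keys_mult_nonneg supp_set_Suc)
qed

theorem theorem3p2:
  fixes i j k N :: nat
  assumes "N \<ge> 1"
  shows "block_proj N ` Supp (struct_const (N * i) (N * j) (N * k))
       = Supp (struct_const i j k ^ N)"
proof -
  \<comment> \<open>Scaling by \<open>N \<ge> 1\<close> preserves the range of indices, so both
    supports are empty in the same cases; there \<open>0 ^ N = 0\<close> again uses
    \<open>N \<ge> 1\<close>.\<close>
  have range_iff: "N * i \<le> N * k \<and> N * j \<le> N * k \<and> N * k \<le> N * i + N * j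
      \<longleftrightarrow> i \<le> k \<and> j \<le> k \<and> k \<le> i + j"
    using assms by (simp flip: add_mult_distrib2)
  have diff: "N * i + N * j - N * k = N * (i + j - k)"
    by (simp add: add_mult_distrib2 diff_mult_distrib2)
  have "block_sum N ` supp_set (N * i) (N * j) (N * k) = Poly_Mapping.keys (struct_const i j k ^ N)"
  proof (cases "i \<le> k \<and> j \<le> k \<and> k \<le> i + j")
    case True
    then have "Poly_Mapping.keys (struct_const i j k) = ballot 1 k (i + j - k)"
      using struct_const_nonneg_keys[of i j k] by (simp add: supp_set_def)
    then have "Poly_Mapping.keys (struct_const i j k ^ N) = ballot N k (N * (i + j - k))"
      using struct_const_nonneg_keys by (intro keys_power_ballot) auto
    moreover have "supp_set (N * i) (N * j) (N * k) = ballot 1 (N * k) (N * (i + j - k))"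
      unfolding supp_set_def range_iff diff using True by simp
    ultimately show ?thesis using assms by (simp only: block_sum_ballot)
  next
    case False
    then have "struct_const i j k = 0"
      using struct_const_nonneg_keys[of i j k] by (auto simp: supp_set_def split: if_splits)
    moreover have "supp_set (N * i) (N * j) (N * k) = {}"
      unfolding supp_set_def range_iff using False by (rule if_not_P)
    ultimately show ?thesis using assms by (simp add: zero_power)
  qed
  then show ?thesis
    using struct_const_nonneg_keys by (simp only: block_proj_Supp) (simp add: Supp_def)
qed

end
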